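(* If $\varphi:\mathcal A\to M_n(\mathbb C)$ is a linear isometry, then there exist unitaries $U,V\in M_n(\mathbb C)$ such that $\varphi(A)=UAV$ for every $A\in\mathcal A$.
   Context: $S$ denotes the $n\times n$ nilpotent Jordan block with ones on the superdiagonal and zeros elsewhere. $\mathcal A=\{f(S): f\text{ a complex polynomial}\}$ is the algebra of $n\times n$ upper-triangular Toeplitz matrices. $M_n(\mathbb C)$ carries the operator norm induced by the Euclidean norm on $\mathbb C^n$; a linear isometry is a linear map with $\|\varphi(A)\|=\|A\|$ for all $A$. *)

theory Defs
  imports "HOL-Analysis.Analysis" "HOL-Computational_Algebra.Polynomial"
begin

text \<open>n x n complex matrices are rendered as complex^'n^'n, where the index type 'n
  is finite and linearly ordered (the order fixes the enumeration 1..n of coordinates).\<close>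

definition jordan_S :: "complex^('n::{finite,linorder})^('n::{finite,linorder})" where
  "jordan_S = (\<chi> i j. if i < j \<and> \<not> (\<exists>k. i < k \<and> k < j) then 1 else 0)"

definition cmat_scale :: "complex \<Rightarrow> complex^'n^'m \<Rightarrow> complex^'n^'m" where
  "cmat_scale c A = (\<chi> i j. c * A $ i $ j)"

definition mat_pow :: "complex^'n^'n \<Rightarrow> nat \<Rightarrow> complex^'n^'n" where
  "mat_pow A k = (((**) A) ^^ k) (mat 1)"

text \<open>Evaluation of a complex polynomial at a square matrix.\<close>
definition poly_mat :: "complex poly \<Rightarrow> complex^'n^'n \<Rightarrow> complex^'n^'n" where
  "poly_mat f A = (\<Sum>k\<le>degree f. cmat_scale (coeff f k) (mat_pow A k))"

definition toeplitz_alg :: "(complex^('n::{finite,linorder})^('n::{finite,linorder})) set" where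
  "toeplitz_alg = {poly_mat f jordan_S | f. True}"

text \<open>Operator norm induced by the Euclidean norm on C^n.\<close>
definition op_norm :: "complex^'n^'m \<Rightarrow> real" where
  "op_norm A = onorm (\<lambda>x. A *v x)"

definition cadjoint :: "complex^'n^'m \<Rightarrow> complex^'m^'n" where
  "cadjoint A = (\<chi> i j. cnj (A $ j $ i))"

definition unitary_mat :: "complex^'n^'n \<Rightarrow> bool" where
  "unitary_mat U \<longleftrightarrow> U ** cadjoint U = mat 1 \<and> cadjoint U ** U = mat 1"

end

theory Submission
  imports Defs
begin

text \<open>
  Let \<open>T k = \<phi> (S\<^sup>k)\<close>. For unimodular \<open>w\<close> the element \<open>B = 1 + 2 (\<Sum>k=1..n-1. w\<^sup>k S\<^sup>k)\<close> has as
  real part \<open>n\<close> times a projection of rank one, so \<open>\<parallel>1 + e B\<parallel> \<ge> 1 + e n\<close> and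
  \<open>\<parallel>1 - e B\<parallel> \<le> 1 + O(e\<^sup>2)\<close> for \<open>e > 0\<close>. Transported by \<open>\<phi>\<close>, the second estimate says that the
  real part \<open>P w\<close> of \<open>(T 0)\<^sup>* \<phi> B\<close> is positive on the space \<open>E\<close> where \<open>T 0\<close> is isometric, and the
  first one yields a unit vector of \<open>E\<close> on which the form of \<open>P w\<close> is at least \<open>n\<close>.
  When \<open>w\<close> runs through the \<open>n\<close> points of a rotated set of \<open>n\<close>-th roots of unity, the \<open>P w\<close> add
  up to \<open>n\<close> on \<open>E\<close>, so that these \<open>n\<close> vectors are orthonormal, \<open>T 0\<close> is unitary, and each
  \<open>P w / n\<close> is the projection on one of them. Fourier inversion of this spectral decomposition, for
  several rotations, shows that \<open>R k = (T 0)\<^sup>* T k\<close> satisfies \<open>R k = (R 1)\<^sup>k\<close> and \<open>(R 1)\<^sup>n = 0\<close>.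
  Since \<open>R 1\<close> is a contraction whose power \<open>R (n-1)\<close> still has norm one, a vector at which this
  norm is attained has an orthonormal orbit under \<open>R 1\<close>, and \<open>R 1\<close> is unitarily equivalent to \<open>S\<close>.

  The real inner product of \<open>complex^'n\<close> is the real part of the Hermitian one.
\<close>

type_synonym 'n cvec = "(complex, 'n) vec"
type_synonym 'n cmat = "((complex, 'n) vec, 'n) vec"

section \<open>Complex matrices and the real inner product\<close>

lemma cmat_scale_component [simp]: "cmat_scale c A $ i $ j = c * A $ i $ j"
  by (simp add: cmat_scale_def)

lemma cmat_scale_vec: "cmat_scale c A *v x = c *s (A *v x)"
  by (simp add: matrix_vector_mult_def cmat_scale_def vec_eq_iff sum_distrib_left mult.assoc)

lemma sum_matrix_vec: "(\<Sum>k\<in>K. A k) *v x = (\<Sum>k\<in>K. A k *v (x::complex^'n))"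
  by (induction K rule: infinite_finite_induct)
     (simp_all add: matrix_vector_mult_add_rdistrib)

lemma scaleR_as_scale: "r *\<^sub>R (x::complex^'n) = complex_of_real r *s x"
  by (simp add: vec_eq_iff scaleR_conv_of_real[where 'a=complex])

lemma matrix_vec_scaleR: "A *v (r *\<^sub>R x) = r *\<^sub>R (A *v (x::complex^'n))"
  by (simp add: scaleR_as_scale vector_scalar_commute)

lemma matrix_vec_linear: "linear (\<lambda>x. A *v (x::complex^'n))"
  by (rule linearI) (simp_all add: matrix_vector_right_distrib matrix_vec_scaleR)

lemma inner_scale_left: "(c *s x) \<bullet> (y::complex^'n) = x \<bullet> (cnj c *s y)"
  unfolding inner_vec_def by (intro sum.cong) (auto simp: inner_complex_def algebra_simps)

lemma inner_cadjoint: "(A *v x) \<bullet> y = (x::complex^'n) \<bullet> (cadjoint A *v (y::complex^'m))"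
proof -
  have "(A *v x) \<bullet> y = (\<Sum>i\<in>UNIV. \<Sum>j\<in>UNIV. (A$i$j * x$j) \<bullet> y$i)"
    by (simp add: inner_vec_def matrix_vector_mult_def inner_sum_left)
  also have "\<dots> = (\<Sum>j\<in>UNIV. \<Sum>i\<in>UNIV. (A$i$j * x$j) \<bullet> y$i)"
    by (rule sum.swap)
  also have "\<dots> = (\<Sum>j\<in>UNIV. \<Sum>i\<in>UNIV. x$j \<bullet> (cnj (A$i$j) * y$i))"
    by (intro sum.cong) (auto simp: inner_complex_def algebra_simps)
  also have "\<dots> = x \<bullet> (cadjoint A *v y)"
    by (simp add: inner_vec_def matrix_vector_mult_def inner_sum_right cadjoint_def)
  finally show ?thesis .
qed

lemma inner_cadjoint': "x \<bullet> (A *v y) = (cadjoint A *v x) \<bullet> (y::complex^'n)"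
  by (metis inner_cadjoint inner_commute)

lemma inner_scale_scale: "(c *s x) \<bullet> (c *s y) = (cmod c)\<^sup>2 * (x \<bullet> (y::complex^'n))"
proof -
  have "cnj c * c = complex_of_real ((cmod c)\<^sup>2)"
    by (metis complex_norm_square mult.commute)
  then have "(c *s x) \<bullet> (c *s y) = x \<bullet> ((cmod c)\<^sup>2 *\<^sub>R y)"
    by (simp only: inner_scale_left vector_smult_assoc scaleR_as_scale)
  then show ?thesis
    by simp
qed

lemma norm_scale: "norm (c *s (x::complex^'n)) = cmod c * norm x"
  by (simp add: norm_eq_sqrt_inner inner_scale_scale real_sqrt_mult)

lemma cadjoint_mult: "cadjoint (A ** B) = cadjoint B ** cadjoint A"
  by (simp add: cadjoint_def matrix_matrix_mult_def vec_eq_iff mult.commute)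

lemma cadjoint_cadjoint [simp]: "cadjoint (cadjoint A) = A"
  by (simp add: cadjoint_def vec_eq_iff)

lemma cadjoint_mat_1 [simp]: "cadjoint (mat 1) = mat 1"
  by (simp add: cadjoint_def vec_eq_iff mat_def)

lemma cadjoint_0 [simp]: "cadjoint 0 = 0"
  by (simp add: cadjoint_def vec_eq_iff)

lemma cadjoint_scale: "cadjoint (cmat_scale c A) = cmat_scale (cnj c) (cadjoint A)"
  by (simp add: cadjoint_def vec_eq_iff)

lemma cadjoint_sum: "cadjoint (\<Sum>k\<in>K. A k) = (\<Sum>k\<in>K. cadjoint (A k))"
  by (simp add: cadjoint_def vec_eq_iff)

lemma cmat_scale_mult_right: "A ** cmat_scale c B = cmat_scale c (A ** B)"
  by (simp add: matrix_matrix_mult_def vec_eq_iff sum_distrib_left mult.left_commute)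

lemma matrix_mult_sum_right: "A ** (\<Sum>k\<in>K. B k) = (\<Sum>k\<in>K. A ** (B k::complex^'n^'m))"
  by (induction K rule: infinite_finite_induct)
     (simp_all add: matrix_add_ldistrib)

lemma unitary_matI: "cadjoint U ** U = mat 1 \<Longrightarrow> unitary_mat U"
  by (simp add: unitary_mat_def matrix_left_right_inverse)

lemma unitary_mat_mult: "unitary_mat U \<Longrightarrow> unitary_mat V \<Longrightarrow> unitary_mat (U ** V)"
  unfolding unitary_mat_def cadjoint_mult
  by (metis matrix_mul_assoc matrix_mul_rid)

lemma unitary_mat_cadjoint: "unitary_mat U \<Longrightarrow> unitary_mat (cadjoint U)"
  by (simp add: unitary_mat_def)

lemma norm_unitary: "cadjoint U ** U = mat 1 \<Longrightarrow> norm (U *v x) = norm (x::complex^'n)"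
  by (simp add: norm_eq_sqrt_inner inner_cadjoint matrix_vector_mul_assoc)

text \<open>Orthogonality of \<open>x\<close> to every complex multiple of \<open>y\<close> for the real inner product is
  orthogonality for the Hermitian one.\<close>
lemma orthonormal_columns:
  fixes x :: "'n::finite \<Rightarrow> complex^'m::finite"
  assumes norm: "\<And>i. norm (x i) = 1"
    and orth: "\<And>i k c. i \<noteq> k \<Longrightarrow> x i \<bullet> (c *s x k) = 0"
  defines "X \<equiv> \<chi> m i. x i $ m"
  shows "cadjoint X ** X = mat 1"
proof -
  define z where "z i k = (\<Sum>m\<in>UNIV. cnj (x i $ m) * x k $ m)" for i k
  have inner: "x i \<bullet> (c *s x k) = Re (c * z i k)" for i k c
    unfolding z_def inner_vec_def sum_distrib_left Re_sum
    by (intro sum.cong) (auto simp: inner_complex_def algebra_simps)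
  have "z i k = 0" if "i \<noteq> k" for i k
  proof -
    have "Re (z i k) = 0" "Re (\<i> * z i k) = 0"
      using inner[of i 1 k] inner[of i "\<i>" k] orth[OF that] by (metis mult_1, metis)
    then show ?thesis
      by (simp add: complex_eq_iff)
  qed
  moreover have "z i i = 1" for i
  proof (rule complex_eqI)
    show "Re (z i i) = Re 1"
      using inner[of i 1 i] norm[of i] by (simp add: norm_eq_1)
    show "Im (z i i) = Im 1"
      by (simp add: z_def mult.commute)
  qed
  ultimately show ?thesis
    by (auto simp: vec_eq_iff matrix_matrix_mult_def cadjoint_def X_def mat_def z_def)
qed

section \<open>Operator norm, contractions and positive forms\<close>

lemma op_norm_bounded_linear: "bounded_linear (\<lambda>x. A *v (x::complex^'n))"
  using matrix_vec_linear linear_conv_bounded_linear by blast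

lemma norm_le_op_norm: "norm (A *v x) \<le> op_norm A * norm (x::complex^'n)"
  unfolding op_norm_def by (rule onorm[OF op_norm_bounded_linear])

lemma op_norm_le: "(\<And>x. norm (A *v x) \<le> b * norm (x::complex^'n)) \<Longrightarrow> op_norm A \<le> b"
  unfolding op_norm_def by (rule onorm_le)

lemma op_norm_attained: "\<exists>x. norm (x::complex^'n) = 1 \<and> norm (A *v x) = op_norm A"
proof -
  have "continuous_on (sphere 0 1) (\<lambda>x. norm (A *v (x::complex^'n)))"
    by (intro continuous_intros linear_continuous_on op_norm_bounded_linear)
  moreover have "axis undefined 1 \<in> sphere (0::complex^'n) 1"
    by (simp add: norm_axis_1)
  ultimately obtain x where "x \<in> sphere (0::complex^'n) 1"
    "\<forall>y\<in>sphere 0 1. norm (A *v y) \<le> norm (A *v x)"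
    using continuous_attains_sup[OF compact_sphere] by blast
  then have x: "norm x = 1" "\<And>y. norm y = 1 \<Longrightarrow> norm (A *v y) \<le> norm (A *v x)"
    by simp_all
  have "norm (A *v y) \<le> norm (A *v x) * norm y" for y
  proof (cases "y = 0")
    case False
    have "norm (A *v ((1 / norm y) *\<^sub>R y)) \<le> norm (A *v x)"
      using False by (intro x) simp
    then show ?thesis
      using False by (simp add: matrix_vec_scaleR field_simps)
  qed simp
  then have "op_norm A \<le> norm (A *v x)"
    by (rule op_norm_le)
  with norm_le_op_norm[of A x] x(1) show ?thesis
    by auto
qed

lemma contraction_norm:
  assumes "op_norm A \<le> 1"
  shows "norm (A *v (x::complex^'n)) \<le> norm x"
  using norm_le_op_norm[of A x] mult_right_mono[OF assms norm_ge_zero[of x]] by simp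

lemma cadjoint_contraction:
  fixes A :: "complex^'n^'m"
  assumes "op_norm A \<le> 1"
  shows "norm (cadjoint A *v y) \<le> norm y"
proof -
  have "(norm (cadjoint A *v y))\<^sup>2 = y \<bullet> (A *v (cadjoint A *v y))"
    by (simp add: power2_norm_eq_inner inner_cadjoint')
  also have "\<dots> \<le> norm y * norm (A *v (cadjoint A *v y))"
    by (rule norm_cauchy_schwarz)
  also have "\<dots> \<le> norm y * norm (cadjoint A *v y)"
    using contraction_norm[OF assms] by (intro mult_left_mono) auto
  finally have "norm (cadjoint A *v y) * norm (cadjoint A *v y) \<le> norm y * norm (cadjoint A *v y)"
    by (simp add: power2_eq_square)
  then show ?thesis
    by (cases "norm (cadjoint A *v y) = 0") (auto simp: mult_le_cancel_right)
qed

text \<open>The squared distance expands to \<open>|A* A y|^2 - 2 |A y|^2 + |y|^2\<close>, which is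
  at most zero. An equation between norms thus becomes a linear one, whose solutions form a
  subspace.\<close>

lemma contraction_isometric_vector:
  fixes A :: "complex^'n^'m"
  assumes "op_norm A \<le> 1" and "norm (A *v y) = norm y"
  shows "cadjoint A *v (A *v y) = y"
proof -
  have "(norm (cadjoint A *v (A *v y) - y))\<^sup>2
      = (norm (cadjoint A *v (A *v y)))\<^sup>2 - 2 * (norm (A *v y))\<^sup>2 + (norm y)\<^sup>2"
    unfolding power2_norm_eq_inner
    by (simp add: inner_diff inner_cadjoint inner_commute)
  also have "\<dots> \<le> 0"
    using power_mono[OF cadjoint_contraction[OF assms(1), of "A *v y"] norm_ge_zero, of 2] assms(2)
    by simp
  finally show ?thesis
    by simp
qed

text \<open>Along the line through \<open>x\<close> in direction \<open>y\<close> the form has no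
  constant term, so it can stay nonnegative only if its linear term vanishes.\<close>

lemma psd_kernel:
  fixes M :: "'a::real_inner \<Rightarrow> 'a"
  assumes lin: "linear M" and E: "subspace E"
    and sym: "\<And>u v. M u \<bullet> v = u \<bullet> M v"
    and psd: "\<And>u. u \<in> E \<Longrightarrow> 0 \<le> M u \<bullet> u"
    and x: "x \<in> E" "M x \<bullet> x = 0" and y: "y \<in> E"
  shows "M x \<bullet> y = 0"
proof -
  define a b where "a = M y \<bullet> y" and "b = M x \<bullet> y"
  have quad: "0 \<le> 2 * t * b + t\<^sup>2 * a" for t
  proof -
    have "0 \<le> M (x + t *\<^sub>R y) \<bullet> (x + t *\<^sub>R y)"
      using E x y by (intro psd) (auto intro: subspace_add subspace_scale)
    also have "\<dots> = 2 * t * b + t\<^sup>2 * a"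
      using x(2) sym[of y x]
      by (simp add: linear_add[OF lin] linear_scale[OF lin] inner_add a_def b_def
          inner_commute power2_eq_square algebra_simps)
    finally show ?thesis .
  qed
  have a: "0 \<le> a"
    unfolding a_def using psd y by blast
  \<comment> \<open>The minimum would be at \<open>- b / a\<close>; the shifted denominator also
    covers \<open>a = 0\<close>.\<close>
  define t where "t = - b / (a + 1)"
  have t: "t * (a + 1) = - b"
    using a by (simp add: t_def)
  have "0 \<le> (2 * t * b + t\<^sup>2 * a) * (a + 1)\<^sup>2"
    by (intro mult_nonneg_nonneg quad) simp
  also have "\<dots> = 2 * (t * (a + 1)) * b * (a + 1) + (t * (a + 1))\<^sup>2 * a"
    by (simp add: power2_eq_square algebra_simps)
  also have "\<dots> = - (b\<^sup>2 * (a + 2))"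
    unfolding t by (simp add: power2_eq_square algebra_simps)
  finally have "b\<^sup>2 * (a + 2) \<le> 0" by simp
  then show ?thesis
    using a by (simp add: mult_le_0_iff b_def)
qed

section \<open>The shift\<close>

text \<open>The zero-based position of an index; it turns the abstract order into arithmetic on
  exponents.\<close>

definition rk :: "'n::{finite,linorder} \<Rightarrow> nat" where
  "rk i = card {k. k < i}"

lemma rk_mono: "i < j \<Longrightarrow> rk i < rk j"
  unfolding rk_def by (intro psubset_card_mono) auto

lemma rk_less_iff: "rk i < rk j \<longleftrightarrow> i < j"
  by (metis rk_mono linorder_neqE not_less_iff_gr_or_eq)

lemma rk_le_iff: "rk i \<le> rk j \<longleftrightarrow> i \<le> j"
  by (metis rk_less_iff not_le)

lemma rk_eq_iff: "rk i = rk j \<longleftrightarrow> i = j"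
  by (metis rk_less_iff linorder_neqE less_irrefl)

lemma rk_less: "rk (i::'n::{finite,linorder}) < CARD('n)"
  unfolding rk_def by (intro psubset_card_mono) auto

lemma bij_rk: "bij_betw (rk :: 'n \<Rightarrow> nat) UNIV {..<CARD('n::{finite,linorder})}"
proof -
  have inj: "inj (rk :: 'n \<Rightarrow> nat)"
    by (simp add: inj_def rk_eq_iff)
  moreover have "range (rk :: 'n \<Rightarrow> nat) = {..<CARD('n)}"
    by (intro card_subset_eq) (auto simp: rk_less card_image[OF inj])
  ultimately show ?thesis
    by (simp add: bij_betw_def)
qed

lemma ex_rk: "k < CARD('n) \<Longrightarrow> \<exists>i::'n::{finite,linorder}. rk i = k"
  using bij_rk[where 'n='n] unfolding bij_betw_def by (metis imageE lessThan_iff)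

lemma rk_Suc_iff: "rk j = Suc (rk i) \<longleftrightarrow> i < j \<and> \<not> (\<exists>k. i < k \<and> k < j)"
proof
  assume "rk j = Suc (rk i)"
  then show "i < j \<and> \<not> (\<exists>k. i < k \<and> k < j)"
    by (metis rk_less_iff lessI not_less_eq)
next
  assume "i < j \<and> \<not> (\<exists>k. i < k \<and> k < j)"
  then have "{k. k < j} = insert i {k. k < i}"
    by (auto simp: not_less) (metis antisym_conv3 leD)
  then show "rk j = Suc (rk i)"
    by (simp add: rk_def)
qed

lemma sum_rk_delta:
  "(\<Sum>j\<in>UNIV. if rk (j::'n::{finite,linorder}) = k then f j else 0)
    = (if k < CARD('n) then f (THE j. rk j = k) else (0::'a::comm_monoid_add))"
proof (cases "k < CARD('n)")
  case True
  then obtain i :: 'n where "rk i = k"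
    using ex_rk by blast
  then have "rk j = k \<longleftrightarrow> j = i" for j
    using rk_eq_iff[of j i] by simp
  then show ?thesis
    using True by simp
next
  case False
  then have "rk j \<noteq> k" for j :: 'n
    using rk_less by metis
  with False show ?thesis
    by simp
qed

lemma jordan_S_component: "jordan_S $ i $ j = (if rk j = Suc (rk i) then 1 else 0)"
  by (simp add: jordan_S_def rk_Suc_iff)

lemma mat_pow_jordan_S:
  "mat_pow jordan_S k $ i $ (j::'n::{finite,linorder}) = (if rk j = rk i + k then 1 else 0)"
proof (induction k arbitrary: i)
  case 0
  show ?case
    by (auto simp: mat_pow_def mat_def rk_eq_iff)
next
  case (Suc k)
  have "mat_pow jordan_S (Suc k) $ i $ j
      = (\<Sum>m\<in>UNIV. jordan_S $ i $ m * mat_pow jordan_S k $ m $ j)"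
    by (simp add: mat_pow_def matrix_matrix_mult_def)
  also have "\<dots> = (\<Sum>m\<in>UNIV. if rk (m::'n) = Suc (rk i) then if rk j = Suc (rk i) + k then 1 else 0 else 0)"
    by (intro sum.cong) (auto simp: Suc jordan_S_component)
  \<comment> \<open>If \<open>i\<close> is the last index, no \<open>m\<close> contributes; the
    right side is then zero too, because ranks stay below \<open>n\<close>.\<close>
  also have "\<dots> = (if rk j = rk i + Suc k then 1 else 0)"
    using rk_less[of j] by (auto simp: sum_rk_delta)
  finally show ?case .
qed

lemma mat_pow_jordan_S_eq_0:
  "CARD('n::{finite,linorder}) \<le> k \<Longrightarrow> mat_pow (jordan_S :: 'n cmat) k = 0"
proof -
  assume "CARD('n) \<le> k"
  then have "rk j \<noteq> rk i + k" for i j :: 'n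
    using rk_less[of j] by linarith
  then show ?thesis
    by (simp add: vec_eq_iff mat_pow_jordan_S)
qed

lemma mat_pow_0 [simp]: "mat_pow A 0 = mat 1"
  by (simp add: mat_pow_def)

lemma mat_pow_1 [simp]: "mat_pow A (Suc 0) = A"
  by (simp add: mat_pow_def)

text \<open>Each coordinate of \<open>x\<close> appears in at most one coordinate of the image, so
  exchanging the two sums bounds the squared norm.\<close>

lemma op_norm_jordan_S: "op_norm (jordan_S :: 'n::{finite,linorder} cmat) \<le> 1"
proof (rule op_norm_le)
  fix x :: "'n cvec"
  have row: "(norm ((jordan_S *v x) $ i))\<^sup>2
      = (\<Sum>j\<in>UNIV. if rk j = Suc (rk i) then (norm (x $ j))\<^sup>2 else 0)" for i :: 'n
    by (simp add: matrix_vector_mult_def jordan_S_component if_distrib[of "\<lambda>a. a * _"]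
        sum_rk_delta cong: if_cong)
  have "(norm (jordan_S *v x))\<^sup>2
      = (\<Sum>(i::'n)\<in>UNIV. \<Sum>j\<in>UNIV. if rk j = Suc (rk i) then (norm (x $ j))\<^sup>2 else 0)"
    by (simp only: norm_vec_def L2_set_def row[symmetric] real_sqrt_pow2 sum_nonneg zero_le_power2)
  also have "\<dots> = (\<Sum>j\<in>UNIV. \<Sum>(i::'n)\<in>UNIV. if rk j = Suc (rk i) then (norm (x $ j))\<^sup>2 else 0)"
    by (rule sum.swap)
  also have "\<dots> \<le> (\<Sum>j\<in>UNIV. (norm (x $ j))\<^sup>2)"
  proof (rule sum_mono)
    fix j :: 'n
    show "(\<Sum>(i::'n)\<in>UNIV. if rk j = Suc (rk i) then (norm (x $ j))\<^sup>2 else 0) \<le> (norm (x $ j))\<^sup>2"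
    proof (cases "rk j")
      case (Suc k)
      have "(\<Sum>(i::'n)\<in>UNIV. if rk j = Suc (rk i) then (norm (x $ j))\<^sup>2 else 0)
          = (\<Sum>i\<in>UNIV. if rk (i::'n) = k then (norm (x $ j))\<^sup>2 else 0)"
        using Suc by (intro sum.cong) auto
      then show ?thesis
        by (simp add: sum_rk_delta)
    qed simp
  qed
  also have "\<dots> = (norm x)\<^sup>2"
    by (simp add: norm_vec_def L2_set_def sum_nonneg)
  finally show "norm (jordan_S *v x) \<le> 1 * norm x"
    by (simp add: power2_le_iff_abs_le)
qed

text \<open>The power sends the last basis vector to the first. The bound later yields a vector
  whose norm survives \<open>n - 1\<close> applications of a contraction.\<close>

lemma op_norm_mat_pow_jordan_S:
  "1 \<le> op_norm (mat_pow (jordan_S :: 'n::{finite,linorder} cmat) (CARD('n) - 1))"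
proof -
  obtain i j :: 'n where i: "rk i = 0" and j: "rk j = CARD('n) - 1"
    using ex_rk[where 'n='n, of 0] ex_rk[where 'n='n, of "CARD('n) - 1"] by auto
  have "(mat_pow jordan_S (CARD('n) - 1) *v axis j (1::complex)) $ i = 1"
    using i j by (simp add: matrix_vector_mult_def mat_pow_jordan_S axis_def
        if_distrib[of "\<lambda>a. _ * a"] cong: if_cong)
  then have "1 \<le> norm (mat_pow jordan_S (CARD('n) - 1) *v axis j (1::complex))"
    using Finite_Cartesian_Product.norm_nth_le[of "mat_pow jordan_S (CARD('n) - 1) *v axis j (1::complex)" i] by simp
  also have "\<dots> \<le> op_norm (mat_pow (jordan_S :: 'n cmat) (CARD('n) - 1))"
    using norm_le_op_norm[of _ "axis j (1::complex)"] by (simp add: norm_axis_1)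
  finally show ?thesis .
qed

definition shift_sum :: "(nat \<Rightarrow> 'n::finite cmat) \<Rightarrow> (nat \<Rightarrow> complex) \<Rightarrow> 'n cmat" where
  "shift_sum T c = (\<Sum>k<CARD('n). cmat_scale (c k) (T k))"

lemma shift_sum_jordan_S:
  "shift_sum (mat_pow jordan_S) c $ (i::'n::{finite,linorder}) $ j
    = (if i \<le> j then c (rk j - rk i) else 0)"
proof -
  have "shift_sum (mat_pow jordan_S) c $ i $ j
      = (\<Sum>k<CARD('n). if rk j = rk i + k then c k else 0)"
    by (simp add: shift_sum_def mat_pow_jordan_S if_distrib[of "\<lambda>a. _ * a"] cong: if_cong)
  also have "\<dots> = (\<Sum>k<CARD('n). if k = rk j - rk i then if i \<le> j then c k else 0 else 0)"
    by (intro sum.cong) (auto simp: rk_le_iff[symmetric])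
  also have "\<dots> = (if i \<le> j then c (rk j - rk i) else 0)"
    using rk_less[of j] by auto
  finally show ?thesis .
qed

text \<open>The coefficients of the truncation of \<open>(1 + wz)/(1 - wz)\<close>: the real part of the
  corresponding element of the algebra is \<open>n\<close> times a projection of rank one.\<close>
definition peak :: "complex \<Rightarrow> nat \<Rightarrow> complex" where
  "peak w k = (if k = 0 then 1 else 2 * w ^ k)"

text \<open>The substitution \<open>a j = w ^ rk j * v $ j\<close> absorbs \<open>w\<close>. What
  remains is the diagonal plus twice the strict upper triangle of the symmetric \<open>g\<close>,
  which sums to all of \<open>g\<close>, a square.\<close>

lemma peak_quadratic_form:
  fixes v :: "'n::{finite,linorder} cvec"
  assumes w: "cmod w = 1"
  shows "(shift_sum (mat_pow jordan_S) (peak w) *v v) \<bullet> v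
    = (cmod (\<Sum>j\<in>UNIV. w ^ rk j * v $ j))\<^sup>2"
proof -
  define a where "a j = w ^ rk j * v $ j" for j
  define g where "g i j = Re (a j * cnj (a i))" for i j
  define h where "h i j = (if i < j then 2 * g i j else if i = j then g i j else 0)" for i j
  have ww: "w * cnj w = 1"
    using w by (simp add: complex_norm_square[symmetric])
  have g_sym: "g i j = g j i" for i j
    by (simp add: g_def)
  have entry: "Re (shift_sum (mat_pow jordan_S) (peak w) $ i $ j * v $ j * cnj (v $ i)) = h i j" for i j
  proof -
    have diag: "a j * cnj (a i) = w ^ (rk j - rk i) * v $ j * cnj (v $ i)" if "i \<le> j"
    proof -
      have "w ^ rk j * cnj w ^ rk i = w ^ (rk j - rk i) * (w * cnj w) ^ rk i"
        by (simp only: power_mult_distrib mult.assoc[symmetric] power_add[symmetric]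
            le_add_diff_inverse2[OF that[folded rk_le_iff]])
      then have *: "w ^ rk j * cnj w ^ rk i = w ^ (rk j - rk i)"
        by (simp add: ww)
      have "a j * cnj (a i) = (w ^ rk j * cnj w ^ rk i) * (v $ j * cnj (v $ i))"
        by (simp add: a_def mult.assoc mult.left_commute)
      then show ?thesis
        by (simp only: * mult.assoc)
    qed
    consider "i < j" | "i = j" | "j < i" by fastforce
    then show ?thesis
    proof cases
      case 1
      then have "shift_sum (mat_pow jordan_S) (peak w) $ i $ j * v $ j * cnj (v $ i) = 2 * (a j * cnj (a i))"
        using rk_mono[OF 1] diag
        by (auto simp: shift_sum_jordan_S peak_def simp del: complex_cnj_mult)
      moreover have "Re (2 * z) = 2 * Re z" for z
        by simp
      ultimately show ?thesis
        using 1 by (simp only: h_def g_def if_True)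
    next
      case 2
      then have "shift_sum (mat_pow jordan_S) (peak w) $ i $ j * v $ j * cnj (v $ i) = a j * cnj (a i)"
        using diag by (simp only: shift_sum_jordan_S peak_def order.refl if_True diff_self_eq_0 power_0 simp_thms mult_1_left)
      then show ?thesis
        using 2 by (simp only: h_def g_def if_True less_irrefl if_False simp_thms)
    next
      case 3
      then show ?thesis
        by (auto simp: h_def shift_sum_jordan_S)
    qed
  qed
  have "(shift_sum (mat_pow jordan_S) (peak w) *v v) \<bullet> v = (\<Sum>i\<in>UNIV. \<Sum>j\<in>UNIV. h i j)"
    unfolding entry[symmetric]
    by (simp add: inner_vec_def matrix_vector_mult_def inner_sum_left)
       (simp add: inner_complex_def algebra_simps)
  moreover have "(\<Sum>i\<in>UNIV. \<Sum>j\<in>UNIV. h i j) = (\<Sum>i\<in>UNIV. \<Sum>j\<in>UNIV. g i j)"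
  proof -
    have "2 * (\<Sum>i\<in>UNIV. \<Sum>j\<in>UNIV. h i j) = (\<Sum>i\<in>UNIV. \<Sum>j\<in>UNIV. h i j) + (\<Sum>i\<in>UNIV. \<Sum>j\<in>UNIV. h j i)"
      using sum.swap[of h UNIV UNIV] by simp
    also have "\<dots> = (\<Sum>i\<in>UNIV. \<Sum>j\<in>UNIV. h i j + h j i)"
      by (simp add: sum.distrib)
    also have "\<dots> = (\<Sum>i\<in>UNIV. \<Sum>j\<in>UNIV. 2 * g i j)"
      by (intro sum.cong) (auto simp: h_def g_sym)
    finally show ?thesis
      by (simp add: sum_distrib_left[symmetric])
  qed
  moreover have "(cmod (\<Sum>j\<in>UNIV. w ^ rk j * v $ j))\<^sup>2 = (\<Sum>i\<in>UNIV. \<Sum>j\<in>UNIV. g i j)"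
  proof -
    define s where "s = (\<Sum>j\<in>UNIV. w ^ rk j * v $ j)"
    have "(cmod s)\<^sup>2 = Re (cnj s * s)"
      by (metis Re_complex_of_real complex_norm_square mult.commute)
    also have "\<dots> = (\<Sum>i\<in>UNIV. \<Sum>j\<in>UNIV. g i j)"
      unfolding s_def g_def a_def cnj_sum sum_product Re_sum
      by (intro sum.cong refl arg_cong[where f=Re]) (simp add: mult.commute)
    finally show ?thesis
      by (simp add: s_def)
  qed
  ultimately show ?thesis
    by simp
qed

text \<open>A geometric sum whose ratio \<open>q\<close> is an \<open>n\<close>-th root of unity,
  equal to 1 exactly when \<open>n\<close> divides \<open>d\<close>. Integer exponents cover
  conjugates, which are inverses on the unit circle.\<close>

lemma sum_rk_powi:
  fixes l :: complex and d :: int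
  assumes "l \<noteq> 0"
  defines "\<omega> \<equiv> cis (2 * pi / CARD('n::{finite,linorder}))"
  shows "(\<Sum>i\<in>UNIV. (l * \<omega> ^ rk (i::'n)) powi d)
    = (if int CARD('n) dvd d then of_nat CARD('n) * l powi d else 0)"
proof -
  define q where "q = \<omega> powi d"
  have q: "q = cis (2 * pi * d / CARD('n))"
    by (simp add: q_def \<omega>_def cis_power_int algebra_simps)
  have "q ^ CARD('n) = cis (2 * pi * of_int d)"
    unfolding q Complex.DeMoivre by simp
  then have qN: "q ^ CARD('n) = 1"
    by simp
  have "q = 1 \<longleftrightarrow> (\<exists>m::int. 2 * pi * d / CARD('n) = of_int (2 * m) * pi)"
    by (simp add: q cis_conv_exp exp_eq_1)
  also have "\<dots> \<longleftrightarrow> (\<exists>m::int. (of_int d :: real) = of_int (int CARD('n) * m))"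
    by (rule iff_exI) (auto simp: field_simps)
  also have "\<dots> \<longleftrightarrow> int CARD('n) dvd d"
    unfolding of_int_eq_iff dvd_def ..
  finally have q1: "q = 1 \<longleftrightarrow> int CARD('n) dvd d" .
  have "(\<Sum>i\<in>UNIV. (l * \<omega> ^ rk (i::'n)) powi d) = (\<Sum>i\<in>UNIV. l powi d * q ^ rk (i::'n))"
    by (simp add: power_int_mult_distrib q_def power_int_power power_int_power' mult.commute)
  also have "\<dots> = l powi d * (\<Sum>k<CARD('n). q ^ k)"
    unfolding sum_distrib_left[symmetric]
    by (subst sum.reindex_bij_betw[OF bij_rk, where g="\<lambda>k. q ^ k"]) simp
  also have "(\<Sum>k<CARD('n). q ^ k) = (if int CARD('n) dvd d then of_nat CARD('n) else 0)"
    using q1 qN by (simp add: sum_gp_strict)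
  finally show ?thesis
    by simp
qed

lemma shift_sum_delta:
  fixes T :: "nat \<Rightarrow> 'n::finite cmat"
  assumes "k < CARD('n)"
  shows "shift_sum T (\<lambda>j. if j = k then 1 else 0) = T k"
  using assms
  by (simp add: vec_eq_iff shift_sum_def if_distrib[of "\<lambda>a. a * _"] cong: if_cong)

lemma shift_sum_perturb:
  fixes T :: "nat \<Rightarrow> 'n::finite cmat"
  shows "shift_sum T (\<lambda>k. (if k = 0 then 1 else 0) + of_real e * c k) *v x
    = T 0 *v x + e *\<^sub>R (shift_sum T c *v x)"
proof -
  have "shift_sum T (\<lambda>k. (if k = 0 then 1 else 0) + of_real e * c k)
      = shift_sum T (\<lambda>k. if k = 0 then 1 else 0) + cmat_scale (of_real e) (shift_sum T c)"
    by (simp add: vec_eq_iff shift_sum_def sum.distrib distrib_right sum_distrib_left mult.assoc)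
  then show ?thesis
    by (simp add: shift_sum_delta matrix_vector_mult_add_rdistrib cmat_scale_vec scaleR_as_scale)
qed

section \<open>Roots of unity\<close>

text \<open>The \<open>n\<close>-th roots of unity rotated by \<open>l\<close>, indexed by matrix
  indices so that they can label the columns of a basis matrix.\<close>

definition node :: "complex \<Rightarrow> 'n::{finite,linorder} \<Rightarrow> complex" where
  "node l i = l * cis (2 * pi / CARD('n)) ^ rk i"

lemma cmod_node: "cmod l = 1 \<Longrightarrow> cmod (node l i) = 1"
  by (simp add: node_def norm_mult norm_power)

lemma cnj_unimodular: "cmod w = 1 \<Longrightarrow> cnj w = inverse w"
  by (metis complex_norm_square inverse_unique mult.commute of_real_1 power_one)

lemma sum_node_powers:
  assumes l: "cmod l = 1"
  shows "(\<Sum>i\<in>(UNIV::'n::{finite,linorder} set). cnj (node l i) ^ a * node l i ^ b)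
    = (if int CARD('n) dvd int b - int a then of_nat CARD('n) * l powi (int b - int a) else 0)"
proof -
  have "cnj (node l i) ^ a * node l i ^ b = node l i powi (int b - int a)" for i :: 'n
  proof -
    have "cmod (node l i) = 1"
      using l by (rule cmod_node)
    then have "node l i \<noteq> 0"
      by auto
    then show ?thesis
      using cnj_unimodular[OF \<open>cmod (node l i) = 1\<close>]
      by (simp add: power_int_diff divide_inverse power_inverse)
  qed
  moreover have "l \<noteq> 0"
    using l by auto
  ultimately show ?thesis
    by (simp add: node_def sum_rk_powi)
qed

lemma sum_node_diff:
  assumes l: "cmod l = 1" and "a < CARD('n)" "b < CARD('n)"
  shows "(\<Sum>i\<in>(UNIV::'n::{finite,linorder} set). cnj (node l i) ^ a * node l i ^ b)
    = (if a = b then of_nat CARD('n) else 0)"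
proof -
  have "int CARD('n) dvd int b - int a \<longleftrightarrow> a = b"
  proof
    assume dvd: "int CARD('n) dvd int b - int a"
    show "a = b"
    proof (rule ccontr)
      assume "a \<noteq> b"
      then have "int CARD('n) \<le> \<bar>int b - int a\<bar>"
        using dvd_imp_le_int[OF _ dvd] by simp
      then show False
        using assms by linarith
    qed
  qed simp
  then show ?thesis
    by (simp add: sum_node_powers[OF l])
qed

text \<open>\<open>a + b\<close> lies strictly between 0 and \<open>2 n\<close>, so \<open>n\<close>
  is the only multiple of \<open>n\<close> it can be. The rotation leaves the factor
  \<open>cnj l ^ n\<close>, the parameter that is varied later.\<close>

lemma sum_node_add:
  assumes l: "cmod l = 1" and "0 < a" "a < CARD('n)" "b < CARD('n)"
  shows "(\<Sum>i\<in>(UNIV::'n::{finite,linorder} set). cnj (node l i) ^ a * cnj (node l i) ^ b)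
    = (if b = CARD('n) - a then of_nat CARD('n) * cnj l ^ CARD('n) else 0)"
proof -
  have "int CARD('n) dvd int 0 - int (a + b) \<longleftrightarrow> b = CARD('n) - a"
  proof -
    have "CARD('n) dvd a + b \<longleftrightarrow> a + b = CARD('n)"
    proof
      assume "CARD('n) dvd a + b"
      then obtain q where q: "a + b = CARD('n) * q" ..
      have "CARD('n) * q < CARD('n) * 2" "CARD('n) * 0 < CARD('n) * q"
        unfolding q[symmetric] using assms by auto
      then have "q = 1"
        unfolding mult_less_cancel1 by simp
      then show "a + b = CARD('n)"
        using q by simp
    qed simp
    then show ?thesis
      unfolding of_nat_0 diff_0 dvd_minus_iff int_dvd_int_iff using assms by auto
  qed
  moreover have "l powi (int 0 - int CARD('n)) = cnj l ^ CARD('n)"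
    using cnj_unimodular[OF l] by (simp add: power_int_minus power_inverse)
  ultimately show ?thesis
    using sum_node_powers[OF l, of "a + b" 0, where 'n='n] assms
    by (auto simp: power_add)
qed

text \<open>The values at 1 and -1 give \<open>b = 0\<close> and \<open>a + c = 0\<close>; the value
  at \<i> then gives \<open>a - c = 0\<close>. All three points are unimodular, as the application
  demands.\<close>

lemma quadratic_coeffs_0:
  fixes a b c :: "'n::finite cmat"
  assumes eq: "\<And>m. m \<in> {1, -1, \<i>} \<Longrightarrow> a + cmat_scale m b + cmat_scale (m * m) c = 0"
  shows "a = 0"
proof -
  have "a $ i $ j = 0" for i j
  proof -
    have "a $ i $ j + m * b $ i $ j + m * m * c $ i $ j = 0" if "m \<in> {1, -1, \<i>}" for m
      using arg_cong[OF eq[OF that], of "\<lambda>M. M $ i $ j"] by simp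
    from this[of 1] this[of "-1"] this[of "\<i>"]
    have *: "a $ i $ j + b $ i $ j + c $ i $ j = 0" "a $ i $ j - b $ i $ j + c $ i $ j = 0"
      "a $ i $ j + \<i> * b $ i $ j - c $ i $ j = 0"
      by simp_all
    from *(1,2) have "2 * b $ i $ j = 0"
      by algebra
    then have b: "b $ i $ j = 0"
      by simp
    with * have "2 * a $ i $ j = 0"
      by algebra
    then show ?thesis
      by simp
  qed
  then show ?thesis
    by (simp add: vec_eq_iff)
qed

section \<open>Isometric images of the shift algebra\<close>

text \<open>\<open>T k\<close> models the image of the \<open>k\<close>-th power of the shift;
  linearity is built into \<open>shift_sum\<close>, so only the norm identity has to be
  assumed.\<close>

locale shift_isometry =
  fixes T :: "nat \<Rightarrow> 'n::{finite,linorder} cmat"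
  assumes isom: "op_norm (shift_sum T c) = op_norm (shift_sum (mat_pow (jordan_S :: 'n cmat)) c)"
begin

lemma op_norm_T: "k < CARD('n) \<Longrightarrow> op_norm (T k) = op_norm (mat_pow (jordan_S :: 'n cmat) k)"
  using isom[of "\<lambda>j. if j = k then 1 else 0"] by (simp add: shift_sum_delta)

lemma op_norm_T_0: "op_norm (T 0) \<le> 1"
proof -
  have "op_norm (mat 1 :: 'n cmat) \<le> 1"
    by (rule op_norm_le) simp
  then show ?thesis
    using op_norm_T[of 0] by simp
qed

section \<open>First-order norm estimates at the peak elements\<close>

abbreviation F :: "complex \<Rightarrow> 'n cmat" where
  "F w \<equiv> shift_sum T (peak w)"

text \<open>The vector with entries \<open>cnj w ^ rk j\<close> is aligned with the rank-one form,
  which takes the value \<open>n^2\<close> there while the squared norm is \<open>n\<close>.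
  Cauchy-Schwarz turns this into a norm bound.\<close>

lemma op_norm_perturb_ge:
  fixes e :: real
  assumes w: "cmod w = 1"
  shows "1 + e * CARD('n) \<le> op_norm (shift_sum T (\<lambda>k. (if k = 0 then 1 else 0) + of_real e * peak w k))"
proof -
  let ?S = "mat_pow (jordan_S :: 'n cmat)"
  define v :: "'n cvec" where "v = (\<chi> j. cnj w ^ rk j)"
  have ww: "w * cnj w = 1"
    using w by (simp add: complex_norm_square[symmetric])
  have "v \<bullet> v = (\<Sum>j\<in>(UNIV::'n set). 1)"
    unfolding inner_vec_def v_def
    by (intro sum.cong) (simp_all add: power2_norm_eq_inner[symmetric] norm_power w)
  then have vv: "v \<bullet> v = CARD('n)"
    by simp
  have "(\<Sum>j\<in>UNIV. w ^ rk j * v $ j) = (\<Sum>j\<in>(UNIV::'n set). 1)"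
    by (simp add: v_def power_mult_distrib[symmetric] ww)
  then have "(shift_sum ?S (peak w) *v v) \<bullet> v = (real CARD('n))\<^sup>2"
    by (simp add: peak_quadratic_form[OF w])
  then have "(1 + e * CARD('n)) * CARD('n)
      = (shift_sum ?S (\<lambda>k. (if k = 0 then 1 else 0) + of_real e * peak w k) *v v) \<bullet> v"
    unfolding shift_sum_perturb by (simp add: inner_add_left vv power2_eq_square algebra_simps)
  also have "\<dots> \<le> norm (shift_sum ?S (\<lambda>k. (if k = 0 then 1 else 0) + of_real e * peak w k) *v v) * norm v"
    by (rule norm_cauchy_schwarz)
  also have "\<dots> \<le> op_norm (shift_sum ?S (\<lambda>k. (if k = 0 then 1 else 0) + of_real e * peak w k)) * norm v * norm v"
    by (intro mult_right_mono norm_le_op_norm) simp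
  also have "\<dots> = op_norm (shift_sum ?S (\<lambda>k. (if k = 0 then 1 else 0) + of_real e * peak w k)) * CARD('n)"
    unfolding vv[symmetric] by (simp add: power2_norm_eq_inner[symmetric] power2_eq_square)
  finally show ?thesis
    by (simp add: isom)
qed

text \<open>For small \<open>e > 0\<close> the norm of \<open>1 + e B\<close> grows at the rate \<open>n\<close>, the largest
  eigenvalue of the real part of \<open>B\<close>; take a limit of maximising vectors of the image.\<close>
lemma peak_vector:
  assumes w: "cmod w = 1"
  shows "\<exists>x. norm x = 1 \<and> norm (T 0 *v x) = 1 \<and> CARD('n) \<le> (F w *v x) \<bullet> (T 0 *v x)"
proof -
  define e where "e m = inverse (real (Suc m))" for m
  define K where "K = op_norm (F w)"
  have e_pos: "0 < e m" for m
    by (simp add: e_def)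
  have "\<exists>x. norm x = 1 \<and> 1 + e m * CARD('n) \<le> norm (T 0 *v x + e m *\<^sub>R (F w *v x))" for m
    using op_norm_attained[of "shift_sum T (\<lambda>k. (if k = 0 then 1 else 0) + of_real (e m) * peak w k)"]
      op_norm_perturb_ge[OF w, of "e m"] by (auto simp: shift_sum_perturb)
  then obtain x where x: "\<And>m. norm (x m) = 1"
    "\<And>m. 1 + e m * CARD('n) \<le> norm (T 0 *v x m + e m *\<^sub>R (F w *v x m))"
    by metis
  have "seq_compact (sphere (0::'n cvec) 1)"
    by (intro compact_imp_seq_compact compact_sphere)
  moreover have "\<forall>m. x m \<in> sphere 0 1"
    by (simp add: x(1))
  ultimately obtain l r where l: "l \<in> sphere 0 1" and r: "strict_mono r"
    and lim: "(x \<circ> r) \<longlonglongrightarrow> l"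
    by (rule seq_compactE)
  have lim_mult: "(\<lambda>m. A *v x (r m)) \<longlonglongrightarrow> A *v l" for A :: "'n cmat"
    using bounded_linear.tendsto[OF op_norm_bounded_linear lim] by (simp add: o_def)
  have "e \<longlonglongrightarrow> 0"
    unfolding e_def by (rule LIMSEQ_inverse_real_of_nat)
  then have lim_e: "(\<lambda>m. e (r m)) \<longlonglongrightarrow> 0"
    using LIMSEQ_subseq_LIMSEQ[OF _ r] by (simp add: o_def)
  have T0_le: "norm (T 0 *v x m) \<le> 1" for m
    using contraction_norm[OF op_norm_T_0, of "x m"] x(1) by simp
  have F_le: "norm (F w *v x m) \<le> K" for m
    using norm_le_op_norm[of "F w" "x m"] x(1) by (simp add: K_def)
  \<comment> \<open>As \<open>e m\<close> tends to 0, this forces the image of the limit vector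
    under \<open>T 0\<close> to have norm at least 1.\<close>
  have lower: "1 + e m * CARD('n) - e m * K \<le> norm (T 0 *v x m)" for m
  proof -
    have "norm (T 0 *v x m + e m *\<^sub>R (F w *v x m)) \<le> norm (T 0 *v x m) + e m * norm (F w *v x m)"
      using norm_triangle_ineq[of "T 0 *v x m" "e m *\<^sub>R (F w *v x m)"] e_pos[of m] by simp
    also have "\<dots> \<le> norm (T 0 *v x m) + e m * K"
      using mult_left_mono[OF F_le[of m], of "e m"] e_pos[of m] by simp
    finally show ?thesis
      using x(2)[of m] by simp
  qed
  have "(\<lambda>m. 1 + e (r m) * CARD('n) - e (r m) * K) \<longlonglongrightarrow> 1 + 0 * real CARD('n) - 0 * K"
    by (intro tendsto_intros lim_e)
  then have "1 \<le> norm (T 0 *v l)"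
    using LIMSEQ_le[OF _ tendsto_norm[OF lim_mult]] lower by fastforce
  moreover have "norm (T 0 *v l) \<le> 1"
    using contraction_norm[OF op_norm_T_0, of l] l by simp
  \<comment> \<open>Squaring isolates the first-order term: the constant 1 cancels because
    \<open>T 0\<close> is a contraction, and division by \<open>e m\<close> leaves an error that
    vanishes in the limit.\<close>
  moreover have "2 * CARD('n) \<le> 2 * ((F w *v x m) \<bullet> (T 0 *v x m)) + e m * K\<^sup>2" for m
  proof -
    have "1 + 2 * (e m * CARD('n)) \<le> (1 + e m * CARD('n))\<^sup>2"
      using zero_le_square[of "e m * CARD('n)"] by (simp add: power2_eq_square algebra_simps)
    also have "\<dots> \<le> (norm (T 0 *v x m + e m *\<^sub>R (F w *v x m)))\<^sup>2"
      using x(2) e_pos[of m] by (intro power_mono) auto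
    also have "\<dots> = (norm (T 0 *v x m))\<^sup>2 + 2 * e m * ((F w *v x m) \<bullet> (T 0 *v x m))
        + (e m)\<^sup>2 * (norm (F w *v x m))\<^sup>2"
      unfolding power2_norm_eq_inner
      by (simp add: inner_add_left inner_add_right inner_commute power2_eq_square algebra_simps)
    also have "\<dots> \<le> 1 + 2 * e m * ((F w *v x m) \<bullet> (T 0 *v x m)) + (e m)\<^sup>2 * K\<^sup>2"
      using T0_le[of m] F_le[of m] e_pos[of m]
      by (intro add_mono mult_left_mono power_mono power_le_one) auto
    finally have "e m * (2 * CARD('n)) \<le> e m * (2 * ((F w *v x m) \<bullet> (T 0 *v x m)) + e m * K\<^sup>2)"
      by (simp add: power2_eq_square algebra_simps)
    then show ?thesis
      using e_pos[of m] by (simp only: mult_le_cancel_left_pos)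
  qed
  moreover have "(\<lambda>m. 2 * ((F w *v x (r m)) \<bullet> (T 0 *v x (r m))) + e (r m) * K\<^sup>2)
      \<longlonglongrightarrow> 2 * ((F w *v l) \<bullet> (T 0 *v l)) + 0 * K\<^sup>2"
    by (intro tendsto_intros lim_e lim_mult)
  ultimately have "2 * CARD('n) \<le> 2 * ((F w *v l) \<bullet> (T 0 *v l))"
    using LIMSEQ_le_const[of "\<lambda>m. 2 * ((F w *v x (r m)) \<bullet> (T 0 *v x (r m))) + e (r m) * K\<^sup>2"
        "2 * ((F w *v l) \<bullet> (T 0 *v l))" "2 * real CARD('n)"] by simp
  then show ?thesis
    using \<open>1 \<le> norm (T 0 *v l)\<close> \<open>norm (T 0 *v l) \<le> 1\<close> l by (intro exI[of _ l]) simp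
qed

text \<open>In the algebra the peak element has nonnegative real part, so subtracting
  \<open>e\<close> times it from the identity raises the norm only to second order. A negative value
  of the form would make the image at \<open>x\<close> grow to first order.\<close>

lemma peak_nonneg:
  assumes w: "cmod w = 1" and x: "norm (T 0 *v x) = norm x"
  shows "0 \<le> (F w *v x) \<bullet> (T 0 *v x)"
proof (rule ccontr)
  let ?B = "shift_sum (mat_pow (jordan_S :: 'n cmat)) (peak w)"
  define K where "K = (op_norm ?B)\<^sup>2"
  define q where "q = (F w *v x) \<bullet> (T 0 *v x)"
  have bound: "op_norm (shift_sum T (\<lambda>k. (if k = 0 then 1 else 0) + of_real (- e) * peak w k))
      \<le> sqrt (1 + e\<^sup>2 * K)" if "0 < e" for e
    unfolding isom
  proof (rule op_norm_le)
    fix v :: "'n cvec"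
    have "(norm (v + (- e) *\<^sub>R (?B *v v)))\<^sup>2
        = (norm v)\<^sup>2 - 2 * e * ((?B *v v) \<bullet> v) + e\<^sup>2 * (norm (?B *v v))\<^sup>2"
      unfolding power2_norm_eq_inner
      by (simp add: inner_add_left inner_add_right inner_diff_left inner_diff_right inner_commute power2_eq_square algebra_simps)
    also have "\<dots> \<le> (norm v)\<^sup>2 + e\<^sup>2 * (op_norm ?B * norm v)\<^sup>2"
      using that norm_le_op_norm[of ?B v] peak_quadratic_form[OF w, of v]
      by (intro add_mono mult_left_mono power_mono) auto
    also have "\<dots> = (1 + e\<^sup>2 * K) * (norm v)\<^sup>2"
      by (simp add: K_def power2_eq_square algebra_simps)
    finally have "norm (v + (- e) *\<^sub>R (?B *v v)) \<le> sqrt ((1 + e\<^sup>2 * K) * (norm v)\<^sup>2)"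
      by (rule real_le_rsqrt)
    then show "norm (shift_sum (mat_pow jordan_S) (\<lambda>k. (if k = 0 then 1 else 0) + of_real (- e) * peak w k) *v v)
        \<le> sqrt (1 + e\<^sup>2 * K) * norm v"
      unfolding shift_sum_perturb by (simp add: real_sqrt_mult)
  qed
  have ineq: "- (2 * q) \<le> e * (K * (norm x)\<^sup>2)" if e: "0 < e" for e
  proof -
    have K: "0 \<le> 1 + e\<^sup>2 * K"
      by (simp add: K_def)
    have "norm (T 0 *v x + (- e) *\<^sub>R (F w *v x)) \<le> sqrt (1 + e\<^sup>2 * K) * norm x"
      unfolding shift_sum_perturb[symmetric]
      by (intro order_trans[OF norm_le_op_norm] mult_right_mono bound e) simp
    then have "(norm (T 0 *v x + (- e) *\<^sub>R (F w *v x)))\<^sup>2 \<le> (sqrt (1 + e\<^sup>2 * K) * norm x)\<^sup>2"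
      by (intro power_mono) auto
    also have "\<dots> = (1 + e\<^sup>2 * K) * (norm x)\<^sup>2"
      using K by (simp add: power_mult_distrib)
    finally have "(norm (T 0 *v x + (- e) *\<^sub>R (F w *v x)))\<^sup>2 \<le> (1 + e\<^sup>2 * K) * (norm x)\<^sup>2" .
    moreover have "(norm (T 0 *v x + (- e) *\<^sub>R (F w *v x)))\<^sup>2
        = (norm x)\<^sup>2 - 2 * e * q + e\<^sup>2 * (norm (F w *v x))\<^sup>2"
      unfolding x[symmetric] power2_norm_eq_inner q_def
      by (simp add: inner_add_left inner_add_right inner_diff_left inner_diff_right inner_commute power2_eq_square algebra_simps)
    ultimately have "e * (- (2 * q)) \<le> e * (e * (K * (norm x)\<^sup>2)) - e\<^sup>2 * (norm (F w *v x))\<^sup>2"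
      by (simp add: power2_eq_square algebra_simps)
    also have "\<dots> \<le> e * (e * (K * (norm x)\<^sup>2))"
      by simp
    finally show ?thesis
      using e by (simp only: mult_le_cancel_left_pos)
  qed
  assume "\<not> 0 \<le> (F w *v x) \<bullet> (T 0 *v x)"
  then have q: "q < 0"
    by (simp add: q_def)
  \<comment> \<open>Small enough that \<open>e * (K * |x|^2) \<le> - q\<close>, whereas
    \<open>ineq\<close> demands at least \<open>- 2 q\<close>; adding 1 keeps the denominator
    positive.\<close>
  define e where "e = - q / (K * (norm x)\<^sup>2 + 1)"
  have pos: "0 < K * (norm x)\<^sup>2 + 1"
    by (simp add: K_def add_nonneg_pos)
  have e: "0 < e"
    using q pos by (simp add: e_def divide_neg_pos)
  have "e * (K * (norm x)\<^sup>2) \<le> e * (K * (norm x)\<^sup>2 + 1)"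
    using e by simp
  also have "\<dots> = - q"
    using pos by (simp add: e_def)
  finally show False
    using ineq[OF e] q by simp
qed

text \<open>Twice the real part called \<open>P w\<close> in the overview, whence the eigenvalue
  \<open>2 * CARD('n)\<close> below.\<close>

definition M :: "complex \<Rightarrow> 'n cmat" where
  "M w = cadjoint (T 0) ** F w + cadjoint (F w) ** T 0"

lemma M_inner: "(M w *v x) \<bullet> y = (F w *v x) \<bullet> (T 0 *v y) + (T 0 *v x) \<bullet> (F w *v y)"
  by (simp add: M_def matrix_vector_mult_add_rdistrib inner_add_left
      matrix_vector_mul_assoc[symmetric] inner_cadjoint)

lemma M_sym: "(M w *v x) \<bullet> y = x \<bullet> (M w *v y)"
  by (simp add: M_inner inner_commute[of x])
     (simp add: inner_commute)

text \<open>Orthogonality of the nodes kills the powers from 1 to \<open>n - 1\<close>; only the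
  constant coefficient survives.\<close>

lemma sum_F:
  assumes "cmod l = 1"
  shows "(\<Sum>i\<in>UNIV. F (node l (i::'n))) = cmat_scale (of_nat CARD('n)) (T 0)"
proof -
  have peak: "(\<Sum>i\<in>UNIV. peak (node l (i::'n)) k) = (if k = 0 then of_nat CARD('n) else 0)" if "k < CARD('n)" for k
    using sum_node_diff[OF assms, of 0 k, where 'n='n] that
    by (auto simp: peak_def sum_distrib_left[symmetric])
  have "(\<Sum>i\<in>UNIV. F (node l (i::'n))) $ p $ q = of_nat CARD('n) * T 0 $ p $ q" for p q
  proof -
    have "(\<Sum>i\<in>UNIV. F (node l (i::'n))) $ p $ q
        = (\<Sum>i\<in>(UNIV::'n set). \<Sum>k<CARD('n). peak (node l i) k * T k $ p $ q)"
      by (simp add: shift_sum_def)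
    also have "\<dots> = (\<Sum>k<CARD('n). (\<Sum>i\<in>(UNIV::'n set). peak (node l i) k) * T k $ p $ q)"
      by (subst sum.swap) (simp add: sum_distrib_right)
    also have "\<dots> = (\<Sum>k<CARD('n). if k = 0 then of_nat CARD('n) * T k $ p $ q else 0)"
      by (intro sum.cong) (auto simp: peak)
    finally show ?thesis
      by simp
  qed
  then show ?thesis
    by (simp add: vec_eq_iff)
qed

lemma sum_M_inner:
  assumes "cmod l = 1"
  shows "(\<Sum>i\<in>UNIV. (M (node l (i::'n)) *v x) \<bullet> y) = 2 * CARD('n) * ((T 0 *v x) \<bullet> (T 0 *v y))"
proof -
  have "(\<Sum>i\<in>UNIV. (M (node l (i::'n)) *v x) \<bullet> y)
      = ((\<Sum>i\<in>UNIV. F (node l (i::'n))) *v x) \<bullet> (T 0 *v y)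
        + (T 0 *v x) \<bullet> ((\<Sum>i\<in>UNIV. F (node l (i::'n))) *v y)"
    by (simp add: M_inner sum.distrib sum_matrix_vec inner_sum_left inner_sum_right)
  then show ?thesis
    by (simp add: sum_F[OF assms] cmat_scale_vec scaleR_as_scale[of "real CARD('n)", simplified, symmetric])
qed

text \<open>The vectors attached by \<open>peak_vector\<close> to the nodes are orthonormal, because the
  positive forms at the nodes add up to a multiple of the inner product.\<close>
lemma node_basis:
  assumes l: "cmod l = 1"
  obtains x :: "'n \<Rightarrow> 'n cvec" where
    "cadjoint (\<chi> m i. x i $ m) ** (\<chi> m i. x i $ m) = mat 1"
    "cadjoint (T 0) ** T 0 = mat 1"
    "\<And>i j. M (node l j) *v x i = (if i = j then of_nat (2 * CARD('n)) *s x i else 0)"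
proof -
  let ?M = "\<lambda>i. M (node l (i::'n))"
  have "\<forall>i::'n. \<exists>x. norm x = 1 \<and> norm (T 0 *v x) = 1 \<and> CARD('n) \<le> (F (node l i) *v x) \<bullet> (T 0 *v x)"
    using peak_vector cmod_node[OF l] by blast
  then obtain x where x: "\<And>i. norm (x i) = 1" "\<And>i. norm (T 0 *v x i) = 1"
    and peak: "\<And>i. CARD('n) \<le> (F (node l (i::'n)) *v x i) \<bullet> (T 0 *v x i)"
    by metis
  \<comment> \<open>The fixed-point equation makes \<open>E\<close> a subspace, whereas the
    estimates speak of equal norms; \<open>E_iff\<close> joins the two descriptions.\<close>
  define E where "E = {v. cadjoint (T 0) *v (T 0 *v v) = v}"
  have E_iff: "v \<in> E \<longleftrightarrow> norm (T 0 *v v) = norm v" for v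
  proof
    assume "v \<in> E"
    then have "(T 0 *v v) \<bullet> (T 0 *v v) = v \<bullet> v"
      by (simp add: E_def inner_cadjoint)
    then show "norm (T 0 *v v) = norm v"
      by (simp add: norm_eq_sqrt_inner)
  qed (simp add: E_def contraction_isometric_vector[OF op_norm_T_0])
  have E: "subspace E"
    by (auto simp: subspace_def E_def matrix_vector_right_distrib matrix_vec_scaleR)
  have x_E: "c *s x i \<in> E" for c i
    by (simp add: E_iff vector_scalar_commute norm_scale x)
  have inner_E: "(T 0 *v u) \<bullet> (T 0 *v v) = u \<bullet> v" if "v \<in> E" for u v
    using that by (simp add: inner_cadjoint E_def)
  have psd: "0 \<le> (?M i *v v) \<bullet> v" if "v \<in> E" for i v
    using peak_nonneg[OF cmod_node[OF l], of v i] that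
    by (simp add: E_iff M_inner inner_commute[of "T 0 *v v"])
  \<comment> \<open>At \<open>x i\<close> all the forms add up to \<open>2 n\<close>, and the one at
    node \<open>i\<close> alone already reaches this amount. The others, being nonnegative, must
    vanish.\<close>
  have zero: "(?M j *v x i) \<bullet> x i = 0" if "i \<noteq> j" for i j
  proof -
    have "2 * real CARD('n) \<le> (?M i *v x i) \<bullet> x i"
      using peak[of i] by (simp add: M_inner inner_commute[of "T 0 *v x i"])
    moreover have "(?M i *v x i) \<bullet> x i + (\<Sum>j\<in>-{i}. (?M j *v x i) \<bullet> x i) = 2 * CARD('n)"
    proof -
      have "(\<Sum>j\<in>UNIV. (?M j *v x i) \<bullet> x i) = 2 * CARD('n)"
        using inner_E[of "x i" "x i"] x_E[of 1 i] x(1)[of i]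
        by (simp add: sum_M_inner[OF l] norm_eq_1)
      then show ?thesis
        by (simp add: sum.remove[of UNIV i] Compl_eq_Diff_UNIV)
    qed
    moreover have "(?M j *v x i) \<bullet> x i \<le> (\<Sum>j\<in>-{i}. (?M j *v x i) \<bullet> x i)"
      using that x_E[of 1 i] by (intro member_le_sum psd) auto
    ultimately show ?thesis
      using psd[of "x i" j] x_E[of 1 i] by simp
  qed
  have kernel: "(?M j *v (c *s x i)) \<bullet> v = 0" if "i \<noteq> j" "v \<in> E" for i j c v
  proof (rule psd_kernel[of "\<lambda>v. ?M j *v v" E])
    show "(?M j *v (c *s x i)) \<bullet> (c *s x i) = 0"
      by (simp add: vector_scalar_commute inner_scale_scale zero that)
  qed (use that E x_E psd matrix_vec_linear M_sym in auto)
  \<comment> \<open>For each \<open>j\<close> at least one of the two vectors has an index other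
    than \<open>j\<close> and is annihilated by that form on \<open>E\<close>. The scalar
    \<open>c\<close> upgrades real orthogonality to Hermitian orthogonality.\<close>
  have orth: "x i \<bullet> (c *s x k) = 0" if "i \<noteq> k" for i k c
  proof -
    have "(?M j *v x i) \<bullet> (c *s x k) = 0" for j
    proof (cases "j = i")
      case True
      then have "(?M j *v (c *s x k)) \<bullet> x i = 0"
        using that x_E[of 1 i] by (intro kernel) auto
      then show ?thesis
        by (metis M_sym inner_commute)
    next
      case False
      then show ?thesis
        using kernel[of i j "c *s x k" 1] x_E[of c k] by auto
    qed
    then have "2 * CARD('n) * ((T 0 *v x i) \<bullet> (T 0 *v (c *s x k))) = 0"
      using sum_M_inner[OF l, of "x i" "c *s x k"] by simp
    then show ?thesis
      using inner_E[OF x_E, of "x i" c k] by simp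
  qed
  define X where "X = (\<chi> m i. x i $ m)"
  have X: "cadjoint X ** X = mat 1"
    unfolding X_def using x(1) orth by (rule orthonormal_columns)
  \<comment> \<open>\<open>cadjoint (T 0) ** T 0\<close> fixes a whole basis, hence is the identity,
    and \<open>E\<close> is the full space.\<close>
  have "cadjoint (T 0) ** T 0 ** X = X"
  proof -
    have "A ** X = (\<chi> m i. (A *v x i) $ m)" for A :: "'n cmat"
      by (simp add: X_def vec_eq_iff matrix_matrix_mult_def matrix_vector_mult_def)
    moreover have "(cadjoint (T 0) ** T 0) *v x i = x i" for i
      using x_E[of 1 i] by (simp add: E_def matrix_vector_mul_assoc)
    ultimately show ?thesis
      by (simp add: X_def)
  qed
  then have "cadjoint (T 0) ** T 0 ** (X ** cadjoint X) = X ** cadjoint X"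
    by (simp add: matrix_mul_assoc)
  moreover have "X ** cadjoint X = mat 1"
    using X matrix_left_right_inverse by blast
  ultimately have T0: "cadjoint (T 0) ** T 0 = mat 1"
    by simp
  then have E_UNIV: "v \<in> E" for v
    by (simp add: E_def matrix_vector_mul_assoc)
  have off: "?M j *v x i = 0" if "i \<noteq> j" for i j
    using kernel[OF that E_UNIV, of 1] by (metis inner_eq_zero_iff vector_smult_lid)
  have diag: "?M i *v x i = of_nat (2 * CARD('n)) *s x i" for i
  proof -
    have "(?M i *v x i) \<bullet> v = (of_nat (2 * CARD('n)) *s x i) \<bullet> v" for v
    proof -
      have "(?M i *v x i) \<bullet> v = (\<Sum>j\<in>UNIV. if j = i then (?M j *v x i) \<bullet> v else 0)"
        by simp
      also have "\<dots> = (\<Sum>j\<in>UNIV. (?M j *v x i) \<bullet> v)"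
        by (intro sum.cong) (auto simp: off)
      also have "\<dots> = (real (2 * CARD('n)) *\<^sub>R x i) \<bullet> v"
        by (simp add: sum_M_inner[OF l] inner_E[OF E_UNIV])
      finally show ?thesis
        by (simp only: scaleR_as_scale of_real_of_nat_eq)
    qed
    then show ?thesis
      by (metis vector_eq_rdot)
  qed
  show thesis
    using X T0 off diag that unfolding X_def by metis
qed

section \<open>Unitarity of \<open>T 0\<close> and the product rule for the
  \<open>R k\<close>\<close>

lemma T_0_unitary: "unitary_mat (T 0)"
  using node_basis[of 1] by (metis norm_one unitary_matI)

text \<open>Normalised so that \<open>R 0\<close> is the identity. The value 0 from index
  \<open>n\<close> on makes the product rule at \<open>k = n - 1\<close> express nilpotency.\<close>

definition R :: "nat \<Rightarrow> 'n cmat" where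
  "R k = (if k < CARD('n) then cadjoint (T 0) ** T k else 0)"

lemma R_0: "R 0 = mat 1"
  using T_0_unitary by (simp add: R_def unitary_mat_def)

lemma R_N: "R CARD('n) = 0"
  by (simp add: R_def)

lemma M_expansion:
  "M w = (\<Sum>k<CARD('n). cmat_scale (peak w k) (R k)) + (\<Sum>k<CARD('n). cmat_scale (cnj (peak w k)) (cadjoint (R k)))"
proof -
  have "cadjoint (F w) ** T 0 = cadjoint (cadjoint (T 0) ** F w)"
    by (simp add: cadjoint_mult)
  moreover have "cadjoint (T 0) ** F w = (\<Sum>k<CARD('n). cmat_scale (peak w k) (R k))"
    by (simp add: shift_sum_def matrix_mult_sum_right cmat_scale_mult_right R_def)
  ultimately show ?thesis
    by (simp add: M_def cadjoint_sum cadjoint_scale)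
qed

text \<open>Fourier inversion at \<open>n\<close> nodes separates frequencies only modulo
  \<open>n\<close>, so the adjoint part, which carries the negative frequencies, contributes its
  index \<open>n - k\<close> as well.\<close>

lemma sum_M:
  assumes l: "cmod l = 1" and k: "0 < k" "k < CARD('n)"
  shows "(\<Sum>j\<in>UNIV. cmat_scale (cnj (node l (j::'n)) ^ k) (M (node l j)))
    = cmat_scale (of_nat (2 * CARD('n))) (R k + cmat_scale (cnj l ^ CARD('n)) (cadjoint (R (CARD('n) - k))))"
proof -
  let ?w = "\<lambda>j::'n. node l j"
  have c1: "(\<Sum>j\<in>UNIV. cnj (?w j) ^ k * peak (?w j) m) = (if m = k then of_nat (2 * CARD('n)) else 0)"
    if "m < CARD('n)" for m
  proof -
    have "(\<Sum>j\<in>UNIV. cnj (?w j) ^ k * peak (?w j) m)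
        = (if m = 0 then 1 else 2) * (\<Sum>j\<in>UNIV. cnj (?w j) ^ k * ?w j ^ m)"
      by (simp add: peak_def sum_distrib_left mult.left_commute)
    then show ?thesis
      using k that by (auto simp: sum_node_diff[OF l])
  qed
  have c2: "(\<Sum>j\<in>UNIV. cnj (?w j) ^ k * cnj (peak (?w j) m))
      = (if m = CARD('n) - k then of_nat (2 * CARD('n)) * cnj l ^ CARD('n) else 0)" if "m < CARD('n)" for m
  proof -
    have "(\<Sum>j\<in>UNIV. cnj (?w j) ^ k * cnj (peak (?w j) m))
        = (if m = 0 then 1 else 2) * (\<Sum>j\<in>UNIV. cnj (?w j) ^ k * cnj (?w j) ^ m)"
      by (simp add: peak_def sum_distrib_left mult.left_commute)
    then show ?thesis
      using k that by (auto simp: sum_node_add[OF l])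
  qed
  have "(\<Sum>j\<in>UNIV. cmat_scale (cnj (?w j) ^ k) (M (?w j))) $ p $ q
      = of_nat (2 * CARD('n)) * (R k $ p $ q + cnj l ^ CARD('n) * cadjoint (R (CARD('n) - k)) $ p $ q)" for p q
  proof -
    have "(\<Sum>j\<in>UNIV. cmat_scale (cnj (?w j) ^ k) (M (?w j))) $ p $ q
        = (\<Sum>j\<in>UNIV. \<Sum>m<CARD('n). cnj (?w j) ^ k * peak (?w j) m * R m $ p $ q)
          + (\<Sum>j\<in>UNIV. \<Sum>m<CARD('n). cnj (?w j) ^ k * cnj (peak (?w j) m) * cadjoint (R m) $ p $ q)"
      by (simp add: M_expansion distrib_left sum.distrib sum_distrib_left mult.assoc)
    also have "\<dots> = (\<Sum>m<CARD('n). (\<Sum>j\<in>UNIV. cnj (?w j) ^ k * peak (?w j) m) * R m $ p $ q)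
        + (\<Sum>m<CARD('n). (\<Sum>j\<in>UNIV. cnj (?w j) ^ k * cnj (peak (?w j) m)) * cadjoint (R m) $ p $ q)"
      by (intro arg_cong2[where f="(+)"]; subst sum.swap) (simp_all add: sum_distrib_right)
    also have "\<dots> = (\<Sum>m<CARD('n). if m = k then of_nat (2 * CARD('n)) * R m $ p $ q else 0)
        + (\<Sum>m<CARD('n). if m = CARD('n) - k then of_nat (2 * CARD('n)) * cnj l ^ CARD('n) * cadjoint (R m) $ p $ q else 0)"
      by (intro arg_cong2[where f="(+)"] sum.cong) (auto simp: c1 c2)
    finally show ?thesis
      using k by (simp add: algebra_simps)
  qed
  then show ?thesis
    by (simp add: vec_eq_iff)
qed

text \<open>\<open>D 1\<close> plays the role of a twisted cyclic shift: all \<open>D k\<close> are diagonal in the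
  basis \<open>x\<close>, with the \<open>k\<close>-th powers of the conjugate nodes as eigenvalues.\<close>
lemma twisted_shift_power:
  assumes l: "cmod l = 1" and k: "k < CARD('n)"
  defines "D \<equiv> \<lambda>k. R k + cmat_scale (cnj l ^ CARD('n)) (cadjoint (R (CARD('n) - k)))"
  shows "D 1 ** D k = D (Suc k)"
proof -
  obtain x :: "'n \<Rightarrow> 'n cvec" where
    X: "cadjoint (\<chi> m i. x i $ m) ** (\<chi> m i. x i $ m) = mat 1"
    and eig: "\<And>i j. M (node l j) *v x i = (if i = j then of_nat (2 * CARD('n)) *s x i else 0)"
    using node_basis[OF l] by metis
  have D_x: "D k *v x i = cnj (node l i) ^ k *s x i" if le: "k \<le> CARD('n)" for k i
  proof -
    \<comment> \<open>\<open>sum_M\<close> covers the middle case. At the two ends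
      \<open>D k\<close> is a scalar matrix, because \<open>R 0\<close> is the identity and
      \<open>R n\<close> is zero.\<close>
    consider "k = 0" | "0 < k" "k < CARD('n)" | "k = CARD('n)"
      using le by linarith
    then show ?thesis
    proof cases
      case 1
      then show ?thesis
        by (simp add: D_def R_0 R_N cmat_scale_def zero_vec_def[symmetric])
    next
      case 2
      have "of_nat (2 * CARD('n)) *s (D k *v x i) = of_nat (2 * CARD('n)) *s (cnj (node l i) ^ k *s x i)"
      proof -
        have "of_nat (2 * CARD('n)) *s (D k *v x i)
            = (\<Sum>j\<in>UNIV. cnj (node l (j::'n)) ^ k *s (M (node l j) *v x i))"
          unfolding D_def cmat_scale_vec[symmetric] sum_M[OF l 2, symmetric]
          by (simp add: sum_matrix_vec)
        also have "\<dots> = (\<Sum>j\<in>UNIV. if j = i then cnj (node l j) ^ k *s (of_nat (2 * CARD('n)) *s x i) else 0)"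
          by (intro sum.cong) (auto simp: eig)
        finally show ?thesis
          by (simp add: vector_smult_assoc mult.commute)
      qed
      then show ?thesis
        by (simp add: vec_eq_iff)
    next
      case 3
      have "cis (2 * pi / CARD('n)) ^ CARD('n) = 1"
        by (simp add: Complex.DeMoivre)
      then have "node l i ^ CARD('n) = l ^ CARD('n)"
        unfolding node_def power_mult_distrib power_mult[symmetric]
        by (metis mult.commute mult_1_right power_mult power_one)
      then have "cnj (node l i) ^ CARD('n) = cnj l ^ CARD('n)"
        by (metis complex_cnj_power)
      then show ?thesis
        using 3 by (simp add: D_def R_0 R_N cmat_scale_vec)
    qed
  qed
  have "(D 1 ** D k) *v x i = D (Suc k) *v x i" for i
    using k D_x[of k i] D_x[of 1 i] D_x[of "Suc k" i]
    by (simp add: matrix_vector_mul_assoc[symmetric] vector_scalar_commute vector_smult_assoc mult.commute)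
  moreover have "A ** (\<chi> m i. x i $ m) = (\<chi> m i. (A *v x i) $ m)" for A :: "'n cmat"
    by (simp add: vec_eq_iff matrix_matrix_mult_def matrix_vector_mult_def)
  ultimately have "(D 1 ** D k) ** (\<chi> m i. x i $ m) = D (Suc k) ** (\<chi> m i. x i $ m)"
    by simp
  from arg_cong[OF this, of "\<lambda>A. A ** cadjoint (\<chi> m i. x i $ m)"] show ?thesis
    unfolding matrix_mul_assoc[symmetric] X[unfolded matrix_left_right_inverse] by simp
qed

text \<open>\<open>twisted_shift_power\<close> is a quadratic identity in the parameter \<open>m\<close>, where \<open>m\<close> is any
  unimodular number; this is the comparison of the constant terms.\<close>
lemma R_mult:
  assumes k: "k < CARD('n)"
  shows "R 1 ** R k = R (Suc k)"
proof -
  have "R 1 ** R k - R (Suc k) = 0"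
  proof (rule quadratic_coeffs_0)
    fix m :: complex
    assume "m \<in> {1, -1, \<i>}"
    then have m: "cmod m = 1"
      by auto
    \<comment> \<open>Chosen so that \<open>z ^ n\<close> is the conjugate of \<open>m\<close>; the
      twist \<open>cnj z ^ n\<close> is then \<open>m\<close> itself.\<close>
    define z where "z = cis (- Arg m / CARD('n))"
    have "cnj z ^ CARD('n) = m"
      using m rcis_cmod_Arg[of m] by (simp add: z_def Complex.DeMoivre cis_cnj rcis_def)
    moreover have "cmod z = 1"
      by (simp add: z_def)
    ultimately have "(R 1 + cmat_scale m (cadjoint (R (CARD('n) - 1)))) ** (R k + cmat_scale m (cadjoint (R (CARD('n) - k))))
        = R (Suc k) + cmat_scale m (cadjoint (R (CARD('n) - Suc k)))"
      using twisted_shift_power[of z k] k by simp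
    moreover have "cmat_scale m A ** B = cmat_scale m (A ** B)" for A B :: "'n cmat"
      by (simp add: vec_eq_iff matrix_matrix_mult_def sum_distrib_left mult.assoc)
    moreover have add_mult: "(A + B) ** C = A ** C + B ** C" for A B C :: "'n cmat"
      by (simp add: vec_eq_iff matrix_matrix_mult_def sum.distrib distrib_right)
    ultimately have "R 1 ** R k + cmat_scale m (R 1 ** cadjoint (R (CARD('n) - k)) + cadjoint (R (CARD('n) - 1)) ** R k)
        + cmat_scale (m * m) (cadjoint (R (CARD('n) - 1)) ** cadjoint (R (CARD('n) - k)))
        = R (Suc k) + cmat_scale m (cadjoint (R (CARD('n) - Suc k)))"
      by (simp add: matrix_add_ldistrib add_mult cmat_scale_mult_right)
         (simp add: vec_eq_iff algebra_simps)
    then show "R 1 ** R k - R (Suc k)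
        + cmat_scale m (R 1 ** cadjoint (R (CARD('n) - k)) + cadjoint (R (CARD('n) - 1)) ** R k - cadjoint (R (CARD('n) - Suc k)))
        + cmat_scale (m * m) (cadjoint (R (CARD('n) - 1)) ** cadjoint (R (CARD('n) - k))) = 0"
      by (simp add: vec_eq_iff algebra_simps)
  qed
  then show ?thesis
    by simp
qed

lemma R_1_mult: "R 1 ** R k = R (Suc k)"
  using R_mult[of k] by (cases "k < CARD('n)") (simp_all add: R_def)

lemma R_add: "R k ** R m = R (k + m)"
proof (induction k)
  case 0
  show ?case by (simp add: R_0)
next
  case (Suc k)
  then show ?case
    by (metis R_1_mult add_Suc matrix_mul_assoc)
qed

section \<open>An orthonormal orbit and the unitary equivalence with the shift\<close>

lemma norm_R: "k < CARD('n) \<Longrightarrow> norm (R k *v x) = norm (T k *v x)"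
  using norm_unitary[of "cadjoint (T 0)" "T k *v x"] T_0_unitary
  by (simp add: R_def unitary_mat_def matrix_vector_mul_assoc)

lemma op_norm_R_1: "op_norm (R 1) \<le> 1"
proof (rule op_norm_le)
  fix x
  show "norm (R 1 *v x) \<le> 1 * norm x"
  proof (cases "1 < CARD('n)")
    case True
    then have "op_norm (T 1) \<le> 1"
      using op_norm_T[of 1] op_norm_jordan_S[where 'n='n] by simp
    then show ?thesis
      using True contraction_norm norm_R by simp
  qed (simp add: R_def)
qed

text \<open>Along the orbit of a maximising vector of \<open>T (n - 1)\<close> the norms do not
  increase, start at 1 and end at no less than 1, so they are constant. Hence \<open>R 1\<close>
  acts isometrically along the orbit up to its last step.\<close>

lemma shift_orbit:
  obtains x :: "'n cvec" where "\<And>k. k < CARD('n) \<Longrightarrow> norm (R k *v x) = 1"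
    "\<And>i j c. i < CARD('n) \<Longrightarrow> j < CARD('n) \<Longrightarrow> i \<noteq> j \<Longrightarrow> (R i *v x) \<bullet> (c *s (R j *v x)) = 0"
proof -
  obtain x where x: "norm x = 1" "norm (T (CARD('n) - 1) *v x) = op_norm (T (CARD('n) - 1))"
    using op_norm_attained by blast
  define y where "y k = R k *v x" for k
  have y_Suc: "R 1 *v y k = y (Suc k)" for k
    by (simp add: y_def matrix_vector_mul_assoc R_1_mult del: One_nat_def)
  have decr: "norm (y m) \<le> norm (y k)" if "k \<le> m" for k m
    using that
  proof (induction rule: dec_induct)
    case (step m)
    then show ?case
      using contraction_norm[OF op_norm_R_1, of "y m"] by (simp only: y_Suc)
  qed simp
  have last: "1 \<le> norm (y (CARD('n) - 1))"
    using op_norm_mat_pow_jordan_S[where 'n='n] op_norm_T[of "CARD('n) - 1"] x(2)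
    by (simp add: y_def norm_R)
  have norm_y: "norm (y k) = 1" if "k < CARD('n)" for k
  proof (rule antisym)
    show "norm (y k) \<le> 1"
      using decr[of 0 k] x(1) by (simp add: y_def R_0)
    have "k \<le> CARD('n) - 1"
      using that by linarith
    then show "1 \<le> norm (y k)"
      using decr[of k "CARD('n) - 1"] last by linarith
  qed
  have iso: "cadjoint (R 1) *v (R 1 *v y k) = y k" if "Suc k < CARD('n)" for k
    using that by (intro contraction_isometric_vector op_norm_R_1) (simp only: y_Suc norm_y Suc_lessD)
  \<comment> \<open>Both indices are raised together, which preserves the inner product because
    \<open>R 1\<close> is isometric at \<open>y i\<close>; the induction ends at
    \<open>y n = 0\<close>.\<close>
  have orth: "y i \<bullet> (c *s y j) = 0" if "i < j" "j \<le> CARD('n)" for i j c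
    using that
  proof (induction "CARD('n) - j" arbitrary: i j)
    case 0
    then have "y j = 0"
      by (simp add: y_def R_def)
    then show ?case
      by simp
  next
    case (Suc d)
    then have "y i \<bullet> (c *s y j) = (cadjoint (R 1) *v (R 1 *v y i)) \<bullet> (c *s y j)"
      by (subst iso) auto
    also have "\<dots> = y (Suc i) \<bullet> (c *s y (Suc j))"
      by (simp only: inner_cadjoint cadjoint_cadjoint vector_scalar_commute y_Suc)
    also have "\<dots> = 0"
      using Suc by (intro Suc.hyps) auto
    finally show ?case .
  qed
  have "y i \<bullet> (c *s y j) = 0" if "i < CARD('n)" "j < CARD('n)" "i \<noteq> j" for i j c
  proof (cases "i < j")
    case False
    have "y i \<bullet> (c *s y j) = y j \<bullet> (cnj c *s y i)"
      by (metis inner_commute inner_scale_left)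
    then show ?thesis
      using False that orth[of j i "cnj c"] by simp
  qed (use orth that in simp)
  then show thesis
    using that[of x] norm_y by (simp add: y_def)
qed

lemma ex_unitary_factors:
  "\<exists>U V. unitary_mat U \<and> unitary_mat V \<and> (\<forall>k<CARD('n). T k = U ** mat_pow jordan_S k ** V)"
proof -
  obtain x where norm: "\<And>k. k < CARD('n) \<Longrightarrow> norm (R k *v x) = 1"
    and orth: "\<And>i j c. i < CARD('n) \<Longrightarrow> j < CARD('n) \<Longrightarrow> i \<noteq> j \<Longrightarrow> (R i *v x) \<bullet> (c *s (R j *v x)) = 0"
    by (rule shift_orbit) blast
  \<comment> \<open>The orbit is reversed, since \<open>R 1\<close> raises orbit positions whereas
    the shift lowers coordinate indices.\<close>
  define y where "y i = R (CARD('n) - 1 - rk i) *v x" for i :: 'n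
  define Y where "Y = (\<chi> m i. y i $ m)"
  have "cadjoint Y ** Y = mat 1"
    unfolding Y_def
  proof (rule orthonormal_columns)
    show "norm (y i) = 1" for i
      by (simp add: y_def norm)
    show "y i \<bullet> (c *s y k) = 0" if "i \<noteq> k" for i k c
    proof -
      have "CARD('n) - 1 - rk i \<noteq> CARD('n) - 1 - rk k"
        using that rk_less[of i] rk_less[of k] rk_eq_iff[of i k] by linarith
      then show ?thesis
        unfolding y_def by (intro orth) auto
    qed
  qed
  then have Y: "unitary_mat Y"
    by (rule unitary_matI)
  have intertwine: "R k ** Y = Y ** mat_pow jordan_S k" for k
  proof -
    have "(R k ** Y) $ m $ j = (Y ** mat_pow jordan_S k) $ m $ j" for m j
    proof -
      have "(R k ** Y) $ m $ j = (R k *v y j) $ m"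
        by (simp add: Y_def matrix_matrix_mult_def matrix_vector_mult_def)
      also have "R k *v y j = R (k + (CARD('n) - 1 - rk j)) *v x"
        by (simp add: y_def matrix_vector_mul_assoc R_add)
      also have "\<dots> $ m = (Y ** mat_pow jordan_S k) $ m $ j"
      proof (cases "k \<le> rk j")
        case True
        then obtain i :: 'n where i: "rk i = rk j - k"
          using ex_rk[of "rk j - k"] rk_less[of j] by (metis le_less_trans diff_le_self)
        then have "rk j = rk p + k \<longleftrightarrow> p = i" for p
          using True rk_eq_iff[of p i] by auto
        then have "(Y ** mat_pow jordan_S k) $ m $ j = y i $ m"
          by (simp add: Y_def matrix_matrix_mult_def mat_pow_jordan_S
              if_distrib[of "\<lambda>a. _ * a"] cong: if_cong)
        moreover have "CARD('n) - 1 - rk i = k + (CARD('n) - 1 - rk j)"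
          using i True rk_less[of j] by simp
        ultimately show ?thesis
          by (simp add: y_def)
      next
        case False
        then have "rk j \<noteq> rk p + k" for p :: 'n
          by simp
        then have "(Y ** mat_pow jordan_S k) $ m $ j = 0"
          by (simp add: matrix_matrix_mult_def mat_pow_jordan_S)
        \<comment> \<open>The index is at least \<open>n\<close> here, beyond the cutoff.\<close>
        moreover have "R (k + (CARD('n) - 1 - rk j)) = 0"
          using False rk_less[of j] by (simp add: R_def)
        ultimately show ?thesis
          by simp
      qed
      finally show ?thesis .
    qed
    then show ?thesis
      by (simp add: vec_eq_iff)
  qed
  have "T k = (T 0 ** Y) ** mat_pow jordan_S k ** cadjoint Y" if "k < CARD('n)" for k
  proof -
    have "(T 0 ** Y) ** mat_pow jordan_S k ** cadjoint Y = T 0 ** (R k ** Y) ** cadjoint Y"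
      by (simp only: intertwine matrix_mul_assoc)
    also have "\<dots> = T 0 ** R k"
      using Y by (simp add: unitary_mat_def matrix_mul_assoc[symmetric])
    also have "\<dots> = T k"
      using that T_0_unitary by (simp add: R_def unitary_mat_def matrix_mul_assoc)
    finally show ?thesis ..
  qed
  then show ?thesis
    using unitary_mat_mult[OF T_0_unitary Y] unitary_mat_cadjoint[OF Y] by blast
qed

end

section \<open>Passage from polynomials in the shift to the given isometry\<close>

lemma matrix_mult_sum_left: "(\<Sum>k\<in>K. A k) ** B = (\<Sum>k\<in>K. A k ** (B::complex^'n^'m))"
  by (simp add: vec_eq_iff matrix_matrix_mult_def sum_distrib_right sum.swap[of _ K])

lemma cmat_scale_mult_left: "cmat_scale c A ** B = cmat_scale c (A ** B)"
  by (simp add: matrix_matrix_mult_def vec_eq_iff sum_distrib_left mult.assoc)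

lemma poly_mat_eq_sum:
  "degree f < m \<Longrightarrow> poly_mat f A = (\<Sum>k<m. cmat_scale (coeff f k) (mat_pow A k))"
  unfolding poly_mat_def
  by (rule sum.mono_neutral_left) (auto simp: not_le coeff_eq_0 vec_eq_iff)

lemma toeplitz_algI:
  "(\<Sum>k<m. cmat_scale (c k) (mat_pow jordan_S k)) \<in> toeplitz_alg"
proof -
  define f where "f = (\<Sum>k<m. monom (c k) k)"
  have f: "coeff f k = (if k < m then c k else 0)" for k
    by (simp add: f_def coeff_sum if_distrib cong: if_cong)
  \<comment> \<open>The length \<open>degree f + m + 1\<close> exceeds both the degree and
    \<open>m\<close>, so both sums extend to it by zero terms.\<close>
  have "poly_mat f jordan_S
      = (\<Sum>k<Suc (degree f + m). cmat_scale (coeff f k) (mat_pow jordan_S k))"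
    by (rule poly_mat_eq_sum) simp
  also have "\<dots> = (\<Sum>k<m. cmat_scale (c k) (mat_pow jordan_S k))"
    by (rule sum.mono_neutral_cong_right) (auto simp: f vec_eq_iff)
  finally show ?thesis
    unfolding toeplitz_alg_def by (metis (mono_tags, lifting) mem_Collect_eq)
qed

lemma toeplitz_algE:
  assumes "A \<in> toeplitz_alg"
  obtains m c where "A = (\<Sum>k<m. cmat_scale (c k) (mat_pow jordan_S k))"
  using assms poly_mat_eq_sum[OF lessI] unfolding toeplitz_alg_def by blast

lemma mat_pow_in_toeplitz_alg: "(mat_pow jordan_S k :: 'n::{finite,linorder} cmat) \<in> toeplitz_alg"
proof -
  have "(\<Sum>j<Suc k. cmat_scale (if j = k then 1 else 0) (mat_pow jordan_S j))
      = (mat_pow jordan_S k :: 'n cmat)"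
    by (simp add: vec_eq_iff if_distrib[of "\<lambda>a. a * _"] cong: if_cong)
  then show ?thesis
    by (metis toeplitz_algI)
qed

theorem theorem5p1:
  fixes \<phi> :: "complex^('n::{finite,linorder})^('n::{finite,linorder}) \<Rightarrow> complex^('n::{finite,linorder})^('n::{finite,linorder})"
  assumes add: "\<And>A B. A \<in> toeplitz_alg \<Longrightarrow> B \<in> toeplitz_alg \<Longrightarrow> \<phi> (A + B) = \<phi> A + \<phi> B"
    and hom: "\<And>c A. A \<in> toeplitz_alg \<Longrightarrow> \<phi> (cmat_scale c A) = cmat_scale c (\<phi> A)"
    and isom: "\<And>A. A \<in> toeplitz_alg \<Longrightarrow> op_norm (\<phi> A) = op_norm A"
  shows "\<exists>U V. unitary_mat U \<and> unitary_mat V \<and> (\<forall>A\<in>toeplitz_alg. \<phi> A = U ** A ** V)"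
proof -
  let ?S = "mat_pow (jordan_S :: 'n cmat)"
  have cmat_scale_0: "cmat_scale 0 A = 0" for A :: "'n cmat"
    by (simp add: vec_eq_iff)
  have phi_0: "\<phi> 0 = 0"
    using hom[OF mat_pow_in_toeplitz_alg, of 0] by (simp add: cmat_scale_0)
  have scaled: "cmat_scale c (?S k) \<in> toeplitz_alg" for c k
  proof -
    have "(\<Sum>j<Suc k. cmat_scale (if j = k then c else 0) (?S j)) = cmat_scale c (?S k)"
      by (simp add: vec_eq_iff if_distrib[of "\<lambda>a. a * _"] cong: if_cong)
    then show ?thesis
      by (metis toeplitz_algI)
  qed
  have phi_sum: "\<phi> (\<Sum>k<m. cmat_scale (c k) (?S k)) = (\<Sum>k<m. cmat_scale (c k) (\<phi> (?S k)))" for m c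
    by (induction m) (simp_all add: phi_0 add hom toeplitz_algI scaled mat_pow_in_toeplitz_alg)
  interpret shift_isometry "\<lambda>k. \<phi> (?S k)"
  proof
    show "op_norm (shift_sum (\<lambda>k. \<phi> (?S k)) c) = op_norm (shift_sum ?S c)" for c
      unfolding shift_sum_def phi_sum[symmetric] by (intro isom toeplitz_algI)
  qed
  obtain U V where UV: "unitary_mat U" "unitary_mat V"
    and small: "\<And>k. k < CARD('n) \<Longrightarrow> \<phi> (?S k) = U ** ?S k ** V"
    using ex_unitary_factors by blast
  \<comment> \<open>From exponent \<open>n\<close> on the power of the shift is zero, and both sides
    vanish.\<close>
  have phi_pow: "\<phi> (?S k) = U ** ?S k ** V" for k
    using small[of k] by (cases "k < CARD('n)") (simp_all add: mat_pow_jordan_S_eq_0 phi_0)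
  have "\<phi> A = U ** A ** V" if "A \<in> toeplitz_alg" for A
  proof -
    obtain m c where A: "A = (\<Sum>k<m. cmat_scale (c k) (?S k))"
      using \<open>A \<in> toeplitz_alg\<close> by (rule toeplitz_algE)
    show ?thesis
      unfolding A phi_sum phi_pow
      by (simp only: matrix_mult_sum_right matrix_mult_sum_left cmat_scale_mult_right cmat_scale_mult_left)
  qed
  with UV show ?thesis
    by blast
qed

end
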